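(* For the class $\mathcal{S}_e^*$ of starlike functions associated with the exponential function, the following hold: (i) $R_{\mathcal{S}_{e}^{*}}(\mathcal{G}_1)= \dfrac{e-1}{3e+\sqrt{10e^{2}-2e+1}}\approx 0.1042$; (ii) $R_{\mathcal{S}_{e}^{*}}(\mathcal{G}_2)\geq \dfrac{2(e^2+e-2)}{(2+e)\left(5e+\sqrt{-8+4e+29e^{2}}\right)}\approx 0.1213$; (iii) $R_{\mathcal{S}_{e}^{*}}(\mathcal{G}_3)= \dfrac{2(e^2-1)}{(e+1)\left(4e+\sqrt{4-8e+20e^{2}}\right)}\approx 0.1543$.
   Context: $\mathbb{D}$ is the open unit disc in $\mathbb{C}$. $\mathcal{A}$ is the class of analytic functions $f$ on $\mathbb{D}$ with $f(0)=0$, $f'(0)=1$. $\mathcal{P}$ is the class of analytic functions $p$ on $\mathbb{D}$ with $p(0)=1$ and $\operatorname{Re}p(z)>0$ for all $z\in\mathbb{D}$; $\mathcal{P}(1/2)=\{p\in\mathcal{P}:\operatorname{Re}p(z)>1/2 \text{ for all } z\in\mathbb{D}\}$. Quotients below are understood with removable singularities filled in (in particular at $0$). Define $\mathcal{G}_1=\{f\in\mathcal{A}: f/g\in\mathcal{P}\text{ and } g/(zp)\in\mathcal{P}\text{ for some } g\in\mathcal{A},\ p\in\mathcal{P}\}$, $\mathcal{G}_2=\{f\in\mathcal{A}: f/g\in\mathcal{P}\text{ and } g/(zp)\in\mathcal{P}(1/2)\text{ for some } g\in\mathcal{A},\ p\in\mathcal{P}\}$, $\mathcal{G}_3=\{f\in\mathcal{A}: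 f/(zp)\in\mathcal{P}\text{ for some } p\in\mathcal{P}\}$. For subclasses $\mathcal{F},\mathcal{G}$ of $\mathcal{A}$, the $\mathcal{G}$-radius $R_{\mathcal{G}}(\mathcal{F})$ of $\mathcal{F}$ is the largest number $R\in(0,1)$ such that, for every $f\in\mathcal{F}$ and every $0<r<R$, the function $z\mapsto r^{-1}f(rz)$ belongs to $\mathcal{G}$. For analytic $f,g$ on $\mathbb{D}$, $f\prec g$ ($f$ is subordinate to $g$) means $f=g\circ w$ for some analytic $w:\mathbb{D}\to\mathbb{D}$ with $w(0)=0$. For an analytic univalent $\varphi$ on $\mathbb{D}$ with $\varphi(0)=1$, $\mathcal{S}^*(\varphi)=\{f\in\mathcal{A}: zf'(z)/f(z)\prec\varphi(z)\}$. $\mathcal{S}_e^*=\mathcal{S}^*(e^z)$, equivalently $|\log(zf'(z)/f(z))|<1$ on $\mathbb{D}$ (principal logarithm). *)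

theory Defs
  imports "HOL-Complex_Analysis.Complex_Analysis"
begin

text \<open>Functions on the open unit disc are represented by total functions
  \<^typ>\<open>complex \<Rightarrow> complex\<close>. Membership in each class below depends only on the values on the disc.\<close>

abbreviation unit_disc :: "complex set" where
  "unit_disc \<equiv> ball 0 1"

text \<open>The library's \<^const>\<open>remove_sings\<close> replaces the value at each point by the limit there, if it
  exists. At a pole it returns 0, so a quotient with a genuine pole in the disc is never
  holomorphic on it.\<close>

definition quot :: "(complex \<Rightarrow> complex) \<Rightarrow> (complex \<Rightarrow> complex) \<Rightarrow> complex \<Rightarrow> complex" where
  "quot f g = remove_sings (\<lambda>z. f z / g z)"

definition class_A :: "(complex \<Rightarrow> complex) set" where
  "class_A = {f. f holomorphic_on unit_disc \<and> f 0 = 0 \<and> deriv f 0 = 1}"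

definition class_P :: "(complex \<Rightarrow> complex) set" where
  "class_P = {p. p holomorphic_on unit_disc \<and> p 0 = 1 \<and> (\<forall>z\<in>unit_disc. Re (p z) > 0)}"

definition class_P_half :: "(complex \<Rightarrow> complex) set" where
  "class_P_half = {p \<in> class_P. \<forall>z\<in>unit_disc. Re (p z) > 1/2}"

definition class_G1 :: "(complex \<Rightarrow> complex) set" where
  "class_G1 = {f \<in> class_A. \<exists>g\<in>class_A. \<exists>p\<in>class_P.
     quot f g \<in> class_P \<and> quot g (\<lambda>z. z * p z) \<in> class_P}"

definition class_G2 :: "(complex \<Rightarrow> complex) set" where
  "class_G2 = {f \<in> class_A. \<exists>g\<in>class_A. \<exists>p\<in>class_P.
     quot f g \<in> class_P \<and> quot g (\<lambda>z. z * p z) \<in> class_P_half}"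

definition class_G3 :: "(complex \<Rightarrow> complex) set" where
  "class_G3 = {f \<in> class_A. \<exists>p\<in>class_P. quot f (\<lambda>z. z * p z) \<in> class_P}"

definition subordinate :: "(complex \<Rightarrow> complex) \<Rightarrow> (complex \<Rightarrow> complex) \<Rightarrow> bool" where
  "subordinate f g \<longleftrightarrow> f holomorphic_on unit_disc \<and> g holomorphic_on unit_disc \<and>
     (\<exists>w. w holomorphic_on unit_disc \<and> w ` unit_disc \<subseteq> unit_disc \<and> w 0 = 0 \<and>
          (\<forall>z\<in>unit_disc. f z = g (w z)))"

definition starlike_class :: "(complex \<Rightarrow> complex) \<Rightarrow> (complex \<Rightarrow> complex) set" where
  "starlike_class \<phi> = {f \<in> class_A. subordinate (quot (\<lambda>z. z * deriv f z) f) \<phi>}"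

definition starlike_exp :: "(complex \<Rightarrow> complex) set" where
  "starlike_exp = starlike_class exp"

definition radius_candidates ::
    "(complex \<Rightarrow> complex) set \<Rightarrow> (complex \<Rightarrow> complex) set \<Rightarrow> real set" where
  "radius_candidates \<G> \<F> = {R \<in> {0<..<1}. \<forall>f\<in>\<F>. \<forall>r. 0 < r \<and> r < R \<longrightarrow>
     (\<lambda>z. f (complex_of_real r * z) / complex_of_real r) \<in> \<G>}"

text \<open>The radius is the largest candidate. It is given as a relation, so that asserting its value
  includes the claim that a largest candidate exists.\<close>

definition is_radius ::
    "(complex \<Rightarrow> complex) set \<Rightarrow> (complex \<Rightarrow> complex) set \<Rightarrow> real \<Rightarrow> bool" where
  "is_radius \<G> \<F> R \<longleftrightarrow>
     R \<in> radius_candidates \<G> \<F> \<and> (\<forall>R'\<in>radius_candidates \<G> \<F>. R' \<le> R)"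

abbreviation euler_e :: real where
  "euler_e \<equiv> exp 1"

end

theory Submission
  imports Defs
begin

text \<open>Every member of the three classes is \<open>f z = z * h z\<close>, where \<open>h\<close> is a product of two or three
  functions with positive real part, so that \<open>z * f' z / f z - 1\<close> is the sum of the terms
  \<open>z * p' z / p z\<close> over the factors \<open>p\<close> of \<open>h\<close>. Applying the Schwarz--Pick lemma to the Cayley
  transform of \<open>p\<close> bounds such a term by \<open>2 * r / (1 - r\<^sup>2)\<close>, where \<open>r = norm z\<close>
  (\<open>class_P_euler_logderiv_le\<close>); when the real part exceeds one half, the bound improves to
  \<open>r / (1 - r)\<close> (\<open>class_P_half_euler_logderiv_le\<close>).

  The disc of radius \<open>1 - 1/e\<close> about 1 lies in the image of the unit disc under the exponential
  function (\<open>norm_Ln_less_1\<close>). Hence every rescaling \<open>f (r * z) / r\<close> with \<open>r < R\<close> is in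
  the starlike class as soon as the sum of the bounds stays below \<open>1 - 1/e\<close> on the disc of radius
  \<open>R\<close> (\<open>radius_candidateI\<close>). Clearing denominators turns this into a quadratic inequality,
  and the numbers in the theorem are positive roots of such quadratics.

  With \<open>n\<close> factors of positive real part the condition is \<open>2 * n * r / (1 - r\<^sup>2) < 1 - 1/e\<close>. It is
  sharp: for \<open>z * ((1 + z) / (1 - z)) ^ n\<close> all \<open>n\<close> terms attain their bound simultaneously at
  \<open>z = - R\<close>, where \<open>z * f' z / f z\<close> then equals \<open>1/e = exp (- 1)\<close>, a value that \<open>exp w\<close>
  with \<open>norm w < 1\<close> cannot take (\<open>radius_candidate_le_extremal\<close>). The cases \<open>n = 3\<close> and
  \<open>n = 2\<close> give the first and the third radius.

  In the second class the three bounds add up to \<open>(5 * r + r\<^sup>2) / (1 - r\<^sup>2)\<close>, and the resulting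
  quadratic inequality \<open>(2 * e - 1) * r\<^sup>2 + 5 * e * r < e - 1\<close> follows from the one with \<open>e + 2\<close>
  in place of \<open>2 * e - 1\<close>, whose root is the stated lower bound. The radius itself is the
  supremum of the candidates, which is again a candidate and lies below 1 because the second class
  contains the third.\<close>

section \<open>The logarithm near 1\<close>

text \<open>The power series of \<open>Ln (1 + u)\<close> is dominated term by term by that of \<open>- ln (1 - norm u)\<close>, so on a
  circle about 1 the logarithm is largest in modulus at the leftmost point; at distance
  \<open>1 - exp (- 1)\<close> that point is \<open>exp (- 1)\<close>.\<close>

lemma norm_Ln_less_1:
  assumes "norm (u::complex) < 1 - exp (-1)"
  shows "norm (Ln (1 + u)) < 1"
proof -
  have u1: "norm u < 1" using assms exp_gt_zero[of "-1::real"] by linarith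
  have S: "(\<lambda>n. norm u ^ n / real n) sums (- ln (1 - norm u))"
    using sums_minus[OF ln_series'[of "- norm u"]] u1 by simp
  have T: "(\<lambda>n. - ((- u) ^ n) / of_nat n) sums Ln (1 + u)"
    by (rule Ln_series'[OF u1])
  have "norm (Ln (1 + u)) \<le> - ln (1 - norm u)"
    using norm_suminf_le[OF _ sums_summable[OF S], of "\<lambda>n. - ((- u) ^ n) / of_nat n"]
      sums_unique[OF S] sums_unique[OF T]
    by (simp add: norm_divide norm_power)
  also have "\<dots> < 1"
  proof -
    have "exp (-1) < 1 - norm u" using assms by linarith
    then have "ln (exp (-1)) < ln (1 - norm u)"
      using u1 by (subst ln_less_cancel_iff) auto
    then show ?thesis by simp
  qed
  finally show ?thesis .
qed

section \<open>The Schwarz--Pick lemma\<close>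

lemma one_minus_cnj_mult_neq_0:
  assumes "norm (a::complex) < 1" "norm u < 1"
  shows "1 - cnj a * u \<noteq> 0"
proof
  assume "1 - cnj a * u = 0"
  then have "norm (cnj a * u) = 1" by (metis norm_one right_minus_eq)
  then show False using norm_mult_less[of "cnj a" 1 u 1] assms by simp
qed

lemma Moebius_function_has_field_derivative:
  assumes "norm a < 1" "norm u < 1"
  shows "(Moebius_function 0 a has_field_derivative
           (1 - of_real ((norm a)\<^sup>2)) / (1 - cnj a * u)\<^sup>2) (at u)"
proof -
  note nz = one_minus_cnj_mult_neq_0[OF assms]
  have "((\<lambda>z. (z - a) / (1 - cnj a * z)) has_field_derivative
      (1 * (1 - cnj a * u) - (u - a) * (- cnj a)) / ((1 - cnj a * u) * (1 - cnj a * u))) (at u)"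
    using nz by (auto intro!: derivative_eq_intros)
  also have "1 * (1 - cnj a * u) - (u - a) * (- cnj a) = 1 - of_real ((norm a)\<^sup>2)"
    using complex_norm_square[of a] by (simp add: algebra_simps)
  also have "(\<lambda>z. (z - a) / (1 - cnj a * z)) = Moebius_function 0 a"
    by (auto simp: Moebius_function_simple)
  finally show ?thesis by (simp only: power2_eq_square)
qed

text \<open>Moving both \<open>z\<close> and \<open>f z\<close> to the origin by Moebius maps of the disc reduces this to the Schwarz
  lemma. By the chain rule the two maps contribute the derivatives \<open>1 - (norm z)\<^sup>2\<close> and
  \<open>1 / (1 - (norm (f z))\<^sup>2)\<close>.\<close>

lemma Schwarz_Pick:
  assumes hol: "f holomorphic_on ball 0 1" and ran: "\<And>z. norm z < 1 \<Longrightarrow> norm (f z) < 1"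
    and z: "norm z < 1"
  shows "norm (deriv f z) * (1 - (norm z)\<^sup>2) \<le> 1 - (norm (f z))\<^sup>2"
proof -
  define g where "g = Moebius_function 0 (f z) \<circ> f \<circ> Moebius_function 0 (- z)"
  have fz: "norm (f z) < 1" using ran z by simp
  have z': "norm (- z) < 1" using z by simp
  have M1: "\<And>u. norm u < 1 \<Longrightarrow> norm (Moebius_function 0 (- z) u) < 1"
    using Moebius_function_norm_lt_1[OF z'] by simp
  have M0: "Moebius_function 0 (- z) 0 = z" by (simp add: Moebius_function_of_zero)
  have "g holomorphic_on ball 0 1"
    unfolding g_def
  proof (rule holomorphic_on_compose_gen[where t = "ball 0 1"])
    show "Moebius_function 0 (- z) holomorphic_on ball 0 1"
      by (rule Moebius_function_holomorphic[OF z'])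
    show "Moebius_function 0 (f z) \<circ> f holomorphic_on ball 0 1"
      by (rule holomorphic_on_compose_gen[OF hol Moebius_function_holomorphic[OF fz]])
         (use ran in auto)
  qed (use M1 in auto)
  moreover have "g 0 = 0" by (simp add: g_def M0 Moebius_function_eq_zero)
  moreover have "norm (g u) < 1" if "norm u < 1" for u
    using Moebius_function_norm_lt_1[OF fz ran[OF M1[OF that]]] by (simp add: g_def)
  ultimately have le: "norm (deriv g 0) \<le> 1"
    by (rule Schwarz_Lemma(2)[where \<xi> = 0]) auto
  have df: "(f has_field_derivative deriv f z) (at z)"
    using hol z by (intro holomorphic_derivI[of _ "ball 0 1"]) auto
  have nn: "(norm z)\<^sup>2 < 1" "(norm (f z))\<^sup>2 < 1"
    using z fz by (auto simp: power_less_one_iff abs_square_less_1)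
  let ?A = "complex_of_real (1 - (norm (f z))\<^sup>2)"
  let ?B = "complex_of_real (1 - (norm z)\<^sup>2)"
  have dM1: "(Moebius_function 0 (- z) has_field_derivative ?B) (at 0)"
    using Moebius_function_has_field_derivative[OF z', of 0] by simp
  have "(Moebius_function 0 (f z) has_field_derivative ?A / (1 - cnj (f z) * f z)\<^sup>2) (at (f z))"
    using Moebius_function_has_field_derivative[OF fz fz] by simp
  moreover have "1 - cnj (f z) * f z = ?A"
    using complex_norm_square[of "f z"] by (simp add: mult.commute)
  moreover have "x / x\<^sup>2 = 1 / x" for x :: complex by (simp add: power2_eq_square)
  ultimately have dM2: "(Moebius_function 0 (f z) has_field_derivative 1 / ?A) (at (f z))"
    by (simp only:)
  have "(f \<circ> Moebius_function 0 (- z) has_field_derivative deriv f z * ?B) (at 0)"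
    by (rule DERIV_chain[OF _ dM1]) (simp add: M0 df)
  then have "(g has_field_derivative (1 / ?A * (deriv f z * ?B))) (at 0)"
    unfolding g_def comp_assoc
    by (rule DERIV_chain[rotated]) (use dM2 in \<open>simp only: o_apply M0\<close>)
  then have "deriv g 0 = 1 / ?A * (deriv f z * ?B)" by (rule DERIV_imp_deriv)
  moreover have "norm ?A = 1 - (norm (f z))\<^sup>2" "norm ?B = 1 - (norm z)\<^sup>2"
    using nn by (auto simp only: norm_of_real)
  ultimately have "norm (deriv f z) * (1 - (norm z)\<^sup>2) / (1 - (norm (f z))\<^sup>2) \<le> 1"
    using le by (simp only: norm_mult norm_divide norm_one) simp
  then show ?thesis using nn by (simp add: divide_simps)
qed

section \<open>Logarithmic derivatives of functions with positive real part\<close>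

text \<open>The logarithmic derivative with respect to the Euler operator \<open>z * d/dz\<close>. For
  \<open>f z = z * h z\<close>, the quantity \<open>z * f' z / f z\<close> that defines starlike classes is
  \<open>1 + euler_logderiv h z\<close>.\<close>

definition euler_logderiv :: "(complex \<Rightarrow> complex) \<Rightarrow> complex \<Rightarrow> complex" where
  "euler_logderiv h z = z * deriv h z / h z"

lemma euler_logderiv_mult:
  assumes "p holomorphic_on unit_disc" "q holomorphic_on unit_disc" "z \<in> unit_disc"
    and "p z \<noteq> 0" "q z \<noteq> 0"
  shows "euler_logderiv (\<lambda>z. p z * q z) z = euler_logderiv p z + euler_logderiv q z"
proof -
  have "(p has_field_derivative deriv p z) (at z)" "(q has_field_derivative deriv q z) (at z)"
    using assms by (auto intro: holomorphic_derivI[of _ unit_disc])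
  then have "((\<lambda>z. p z * q z) has_field_derivative deriv p z * q z + deriv q z * p z) (at z)"
    by (rule DERIV_mult)
  then show ?thesis
    using assms(4,5) unfolding euler_logderiv_def
    by (simp add: DERIV_imp_deriv field_simps)
qed

lemma class_P_D:
  assumes "p \<in> class_P"
  shows "p holomorphic_on unit_disc" "p 0 = 1" "\<And>z. norm z < 1 \<Longrightarrow> Re (p z) > 0"
    "\<And>z. norm z < 1 \<Longrightarrow> p z \<noteq> 0"
  using assms by (force simp: class_P_def)+

text \<open>The Cayley transform \<open>w = (p - 1) / (p + 1)\<close> maps the disc to itself, and
  \<open>1 - (norm w)\<^sup>2 = 4 * Re p / (norm (p + 1))\<^sup>2\<close>. Schwarz--Pick for \<open>w\<close> therefore bounds
  \<open>norm (deriv p z)\<close> in terms of \<open>Re (p z)\<close>, which is at most \<open>norm (p z)\<close>.\<close>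

lemma class_P_euler_logderiv_le:
  assumes p: "p \<in> class_P" and z: "norm z < 1"
  shows "norm (euler_logderiv p z) \<le> 2 * norm z / (1 - (norm z)\<^sup>2)"
proof -
  note P = class_P_D[OF p]
  have nz: "p u + 1 \<noteq> 0" if "norm u < 1" for u
    using P(3)[OF that] by (auto simp: complex_eq_iff)
  define w where "w u = (p u - 1) / (p u + 1)" for u
  have "w holomorphic_on ball 0 1"
    unfolding w_def by (intro holomorphic_intros P) (use nz in auto)
  moreover have "norm (w u) < 1" if "norm u < 1" for u
  proof -
    have "norm (p u - 1) < norm (p u + 1)"
      unfolding norm_lt cmod_def using P(3)[OF that]
      by (intro real_sqrt_less_mono) (simp add: power2_eq_square algebra_simps)
    then show ?thesis using nz[OF that] by (simp add: w_def norm_divide divide_simps)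
  qed
  ultimately have SP: "norm (deriv w z) * (1 - (norm z)\<^sup>2) \<le> 1 - (norm (w z))\<^sup>2"
    using z by (rule Schwarz_Pick)
  have dp: "(p has_field_derivative deriv p z) (at z)"
    using P(1) z by (intro holomorphic_derivI[of _ "ball 0 1"]) auto
  have "(w has_field_derivative
      (deriv p z * (p z + 1) - (p z - 1) * deriv p z) / ((p z + 1) * (p z + 1))) (at z)"
    unfolding w_def using nz[OF z] by (auto intro!: derivative_eq_intros dp)
  then have dw: "deriv w z = 2 * deriv p z / (p z + 1)\<^sup>2"
    by (simp add: DERIV_imp_deriv power2_eq_square algebra_simps)
  have id: "1 - (norm (w z))\<^sup>2 = 4 * Re (p z) / (norm (p z + 1))\<^sup>2"
  proof -
    have "(norm (p z + 1))\<^sup>2 - (norm (p z - 1))\<^sup>2 = 4 * Re (p z)"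
      unfolding cmod_power2 by (simp add: power2_eq_square algebra_simps)
    then have "(norm (p z - 1))\<^sup>2 = (norm (p z + 1))\<^sup>2 - 4 * Re (p z)" by simp
    then show ?thesis using nz[OF z]
      unfolding w_def norm_divide power_divide by (simp add: diff_divide_distrib)
  qed
  have pos: "0 < 1 - (norm z)\<^sup>2" using z by (simp add: power_less_one_iff abs_square_less_1)
  have "norm (deriv p z) * (1 - (norm z)\<^sup>2) \<le> 2 * Re (p z)"
    using SP nz[OF z] unfolding dw id by (simp add: norm_mult norm_divide norm_power divide_simps)
  also have "\<dots> \<le> 2 * norm (p z)" using complex_Re_le_cmod[of "p z"] by simp
  finally have "norm (deriv p z) / norm (p z) \<le> 2 / (1 - (norm z)\<^sup>2)"
    using pos P(4)[OF z] by (simp add: divide_simps)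
  from mult_left_mono[OF this norm_ge_zero[of z]]
  show ?thesis by (simp add: euler_logderiv_def norm_mult norm_divide mult.commute[of _ 2])
qed

text \<open>Here \<open>w = 1 - 1 / p\<close> maps the disc to itself, since \<open>Re p > 1/2\<close> says that \<open>p\<close> is closer to 1 than to
  0. In terms of \<open>w\<close> the logarithmic derivative of \<open>p\<close> is \<open>w' / (1 - w)\<close>. Schwarz--Pick bounds the
  numerator by \<open>(1 - norm w) * (1 + norm w) / (1 - (norm z)\<^sup>2)\<close>; the first factor cancels against the
  denominator, and the Schwarz lemma (\<open>w 0 = 0\<close>) turns the second into \<open>1 + norm z\<close>.\<close>

lemma class_P_half_euler_logderiv_le:
  assumes p: "p \<in> class_P_half" and z: "norm z < 1"
  shows "norm (euler_logderiv p z) \<le> norm z / (1 - norm z)"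
proof -
  have pP: "p \<in> class_P" and half: "\<And>u. norm u < 1 \<Longrightarrow> Re (p u) > 1/2"
    using p by (auto simp: class_P_half_def)
  note P = class_P_D[OF pP]
  define w where "w u = 1 - 1 / p u" for u
  have hw: "w holomorphic_on ball 0 1"
    unfolding w_def by (intro holomorphic_intros P) (use P in auto)
  have nw: "norm (w u) < 1" if "norm u < 1" for u
  proof -
    have "norm (p u - 1) < norm (p u)"
      unfolding cmod_def using half[OF that]
      by (intro real_sqrt_less_mono) (simp add: power2_eq_square algebra_simps)
    then have "norm ((p u - 1) / p u) < 1"
      using P(4)[OF that] by (simp add: norm_divide)
    then show ?thesis using P(4)[OF that] by (simp add: w_def diff_divide_distrib)
  qed
  have w0: "w 0 = 0" by (simp add: w_def P)
  have SP: "norm (deriv w z) * (1 - (norm z)\<^sup>2) \<le> 1 - (norm (w z))\<^sup>2"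
    using hw nw z by (rule Schwarz_Pick)
  have SL: "norm (w z) \<le> norm z" by (rule Schwarz_Lemma(1)[OF hw w0 nw z])
  have dp: "(p has_field_derivative deriv p z) (at z)"
    using P(1) z by (intro holomorphic_derivI[of _ "ball 0 1"]) auto
  have "(w has_field_derivative deriv p z / (p z * p z)) (at z)"
    unfolding w_def using P(4)[OF z] by (auto intro!: derivative_eq_intros dp)
  then have dw: "deriv w z = deriv p z / (p z * p z)" by (rule DERIV_imp_deriv)
  have eq: "deriv p z / p z = deriv w z / (1 - w z)"
    using P(4)[OF z] by (simp add: dw w_def)
  have le: "1 - norm (w z) \<le> norm (1 - w z)"
    using norm_triangle_ineq2[of 1 "w z"] by simp
  let ?a = "norm (w z)" and ?r = "norm z"
  have "norm (deriv w z) * (1 - ?r\<^sup>2) \<le> (1 - ?a) * (1 + ?a)"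
    using SP by (simp add: power2_eq_square algebra_simps)
  also have "\<dots> \<le> norm (1 - w z) * (1 + ?r)"
    using le SL nw[OF z] by (intro mult_mono) auto
  finally have "(norm (deriv w z) * (1 - ?r)) * (1 + ?r) \<le> norm (1 - w z) * (1 + ?r)"
    by (simp add: power2_eq_square algebra_simps)
  then have "norm (deriv w z) * (1 - ?r) \<le> norm (1 - w z)"
    by (rule mult_right_le_imp_le) (smt (verit) norm_ge_zero)
  moreover have "norm (1 - w z) > 0" using le nw[OF z] by linarith
  ultimately have "norm (deriv w z) / norm (1 - w z) \<le> 1 / (1 - ?r)"
    using z by (simp add: divide_simps mult.commute)
  from mult_left_mono[OF this norm_ge_zero[of z]]
  have "norm (z * (deriv p z / p z)) \<le> norm z / (1 - norm z)"
    unfolding eq by (simp add: norm_mult norm_divide)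
  then show ?thesis by (simp add: euler_logderiv_def)
qed

section \<open>Quotients with removable singularities\<close>

text \<open>The factorization is only required away from the origin, where both functions may vanish:
  continuity of \<open>q\<close> determines the value there. This identifies a quotient from a candidate for it;
  conversely, \<open>quot_factor\<close> recovers a factorization from a quotient.\<close>

lemma quot_eqI:
  assumes hol: "q holomorphic_on unit_disc" and z: "z \<in> unit_disc"
    and eq: "\<And>u. u \<in> unit_disc \<Longrightarrow> u \<noteq> 0 \<Longrightarrow> f u = g u * q u"
    and nz: "\<And>u. u \<in> unit_disc \<Longrightarrow> u \<noteq> 0 \<Longrightarrow> g u \<noteq> 0"
  shows "quot f g z = q z"
proof -
  have "\<forall>\<^sub>F u in at z. u \<in> unit_disc - {0} - {z}"
  proof -
    have "\<forall>\<^sub>F u in at z. u \<in> unit_disc" using z by (intro eventually_at_in_open') auto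
    moreover have "\<forall>\<^sub>F u in at z. u \<noteq> 0" by (rule eventually_neq_at_within)
    moreover have "\<forall>\<^sub>F u in at z. u \<noteq> z" by (rule eventually_neq_at_within)
    ultimately show ?thesis by eventually_elim auto
  qed
  then have "\<forall>\<^sub>F u in at z. f u / g u = q u"
    by eventually_elim (use eq nz in auto)
  then have "quot f g z = remove_sings q z"
    unfolding quot_def by (rule remove_sings_cong) simp
  also have "\<dots> = q z"
    by (rule remove_sings_at_analytic)
       (use hol z in \<open>auto simp: analytic_on_open analytic_at intro!: exI[of _ unit_disc]\<close>)
  finally show ?thesis .
qed

lemma quot_eq_divide:
  assumes "f holomorphic_on unit_disc" "g holomorphic_on unit_disc" "z \<in> unit_disc" "g z \<noteq> 0"
  shows "quot f g z = f z / g z"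
proof -
  have "(\<lambda>z. f z / g z) analytic_on {z}"
    using assms by (intro analytic_intros) (auto simp: analytic_at intro: exI[of _ unit_disc])
  then show ?thesis unfolding quot_def by (rule remove_sings_at_analytic)
qed

lemma quot_factor:
  assumes "f holomorphic_on unit_disc" "g holomorphic_on unit_disc" "f 0 = 0" "g 0 = 0"
    and "\<And>u. u \<in> unit_disc \<Longrightarrow> u \<noteq> 0 \<Longrightarrow> g u \<noteq> 0" and "z \<in> unit_disc"
  shows "f z = g z * quot f g z"
  using assms quot_eq_divide[of f g z] by (cases "z = 0") auto

lemma class_P_cong:
  assumes "q \<in> class_P" "\<And>z. z \<in> unit_disc \<Longrightarrow> p z = q z"
  shows "p \<in> class_P"
  using assms holomorphic_cong[of unit_disc unit_disc p q] by (auto simp: class_P_def)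

lemma quot_mult_class_P:
  assumes g: "g holomorphic_on unit_disc" "g 0 = 0"
    and p: "p \<in> class_P"
    and P: "quot g (\<lambda>z. z * p z) \<in> class_P" and z: "z \<in> unit_disc"
  shows "g z = z * p z * quot g (\<lambda>z. z * p z) z"
proof (rule quot_factor[OF g(1) _ g(2) _ _ z])
  show "(\<lambda>z. z * p z) holomorphic_on unit_disc"
    by (intro holomorphic_intros class_P_D p)
qed (use class_P_D(4)[OF p] in auto)

text \<open>Both \<open>f / g\<close> and \<open>g / (z * p)\<close> can be multiplied out: \<open>z * p\<close> vanishes only at the origin because
  \<open>p\<close> has no zeros, and therefore so does \<open>g\<close>, because its quotient by \<open>z * p\<close> has no zeros
  either.\<close>

lemma three_factor_factorization:
  assumes f: "f \<in> class_A" and g: "g \<in> class_A" and p: "p \<in> class_P"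
    and P: "quot f g \<in> class_P" "quot g (\<lambda>z. z * p z) \<in> class_P" and z: "z \<in> unit_disc"
  shows "f z = z * (p z * quot g (\<lambda>z. z * p z) z * quot f g z)"
proof -
  have g_eq: "g u = u * p u * quot g (\<lambda>z. z * p z) u" if "u \<in> unit_disc" for u
    using g by (intro quot_mult_class_P P p that) (auto simp: class_A_def)
  have "f z = g z * quot f g z"
    using f g z g_eq class_P_D(4)[OF p] class_P_D(4)[OF P(2)]
    by (intro quot_factor) (auto simp: class_A_def)
  then show ?thesis using g_eq[OF z] by (simp add: mult_ac)
qed

section \<open>Rescaled functions in the exponential starlike class\<close>

lemma class_A_timesI:
  assumes "h holomorphic_on unit_disc" "h 0 = 1"
  shows "(\<lambda>z. z * h z) \<in> class_A"
proof -
  have "(h has_field_derivative deriv h 0) (at 0)"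
    using assms by (intro holomorphic_derivI[of _ "ball 0 1"]) auto
  then have "((\<lambda>z. z * h z) has_field_derivative 1) (at 0)"
    using assms(2) by (auto intro!: derivative_eq_intros)
  then show ?thesis using assms
    by (auto simp: class_A_def DERIV_imp_deriv intro!: holomorphic_intros)
qed

lemma scaled_in_unit_disc:
  assumes "0 < r" "r < 1" "z \<in> unit_disc"
  shows "complex_of_real r * z \<in> unit_disc"
  using assms mult_strict_mono[of r 1 "norm z" 1] by (simp add: norm_mult)

text \<open>Rescaling \<open>f\<close> replaces \<open>h z\<close> by \<open>h (r * z)\<close>, and the Euler operator commutes with such a dilation.\<close>

lemma scaled_quot:
  fixes r :: real
  assumes h: "h holomorphic_on unit_disc" "\<And>z. z \<in> unit_disc \<Longrightarrow> h z \<noteq> 0"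
    and f: "\<And>z. z \<in> unit_disc \<Longrightarrow> f z = z * h z"
    and r: "0 < r" "r < 1" and z: "z \<in> unit_disc"
  defines "F \<equiv> \<lambda>z. f (of_real r * z) / of_real r"
  shows "quot (\<lambda>z. z * deriv F z) F z = 1 + euler_logderiv h (of_real r * z)"
proof -
  have F: "F u = u * h (of_real r * u)" if "u \<in> unit_disc" for u
    using f[OF scaled_in_unit_disc[OF r that]] r by (simp add: F_def)
  have dF: "deriv F u = h (of_real r * u) + u * (of_real r * deriv h (of_real r * u))"
    if u: "u \<in> unit_disc" for u
  proof -
    have "(h has_field_derivative deriv h (of_real r * u)) (at (of_real r * u))"
      using h(1) scaled_in_unit_disc[OF r u] by (intro holomorphic_derivI[of _ "ball 0 1"]) auto
    then have "((\<lambda>u. h (of_real r * u)) has_field_derivative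
        deriv h (of_real r * u) * of_real r) (at u)"
      by (rule DERIV_chain2) (auto intro!: derivative_eq_intros)
    then have "((\<lambda>u. u * h (of_real r * u)) has_field_derivative
        h (of_real r * u) + u * (of_real r * deriv h (of_real r * u))) (at u)"
      by (auto intro!: derivative_eq_intros)
    then have "(F has_field_derivative
        h (of_real r * u) + u * (of_real r * deriv h (of_real r * u))) (at u)"
      by (rule has_field_derivative_transform_within_open[OF _ open_ball u]) (simp add: F)
    then show ?thesis by (rule DERIV_imp_deriv)
  qed
  show ?thesis
  proof (rule quot_eqI[OF _ z])
    have "(\<lambda>z. 1 + euler_logderiv h z) holomorphic_on unit_disc"
      unfolding euler_logderiv_def by (intro holomorphic_intros h) (use h in auto)
    then have "((\<lambda>z. 1 + euler_logderiv h z) \<circ> (\<lambda>z. of_real r * z)) holomorphic_on unit_disc"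
      using scaled_in_unit_disc[OF r]
      by (intro holomorphic_on_compose_gen[where t = unit_disc]) (auto intro!: holomorphic_intros)
    then show "(\<lambda>z. 1 + euler_logderiv h (of_real r * z)) holomorphic_on unit_disc"
      by (simp add: o_def)
  next
    fix u assume u: "u \<in> unit_disc" "u \<noteq> 0"
    note nz = h(2)[OF scaled_in_unit_disc[OF r u(1)]]
    show "F u \<noteq> 0" using F[OF u(1)] u nz by simp
    show "u * deriv F u = F u * (1 + euler_logderiv h (of_real r * u))"
      unfolding F[OF u(1)] dF[OF u(1)] euler_logderiv_def using nz by (simp add: field_simps)
  qed
qed

text \<open>The Schwarz function that witnesses the subordination is the principal logarithm of
  \<open>1 + euler_logderiv h (r * z)\<close>. It is holomorphic because the argument stays in the right
  half-plane, and it maps into the unit disc by \<open>norm_Ln_less_1\<close>.\<close>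

lemma scaled_starlike_exp:
  assumes h: "h holomorphic_on unit_disc" "h 0 = 1" "\<And>z. z \<in> unit_disc \<Longrightarrow> h z \<noteq> 0"
    and f: "\<And>z. z \<in> unit_disc \<Longrightarrow> f z = z * h z"
    and r: "0 < r" "r < R" "R < 1"
    and bound: "\<And>z. norm z < R \<Longrightarrow> norm (euler_logderiv h z) < 1 - exp (-1)"
  shows "(\<lambda>z. f (complex_of_real r * z) / complex_of_real r) \<in> starlike_exp"
proof -
  have r1: "r < 1" using r by simp
  note disc = scaled_in_unit_disc[OF r(1) r1]
  define F where "F = (\<lambda>z. f (complex_of_real r * z) / complex_of_real r)"
  define Q where "Q z = 1 + euler_logderiv h (of_real r * z)" for z
  have hr: "(\<lambda>z. h (of_real r * z)) holomorphic_on unit_disc"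
    using holomorphic_on_compose_gen[of "\<lambda>z. of_real r * z" unit_disc h unit_disc] h(1) disc
    by (force simp: o_def intro!: holomorphic_intros)
  have qF: "quot (\<lambda>z. z * deriv F z) F z = Q z" if "z \<in> unit_disc" for z
    unfolding F_def Q_def by (rule scaled_quot[OF h(1,3) f r(1) r1 that])
  have E: "(\<lambda>z. euler_logderiv h z) holomorphic_on unit_disc"
    unfolding euler_logderiv_def by (intro holomorphic_intros h) (use h in auto)
  have Qhol: "Q holomorphic_on unit_disc"
    using holomorphic_on_compose_gen[of "\<lambda>z. of_real r * z" unit_disc "euler_logderiv h" unit_disc] E disc
    unfolding Q_def by (force simp: o_def intro!: holomorphic_intros)
  have small: "norm (Q z - 1) < 1 - exp (-1)" if "z \<in> unit_disc" for z
  proof -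
    have "norm (of_real r * z) < R"
      using that r by (simp add: norm_mult order.strict_trans1[OF mult_left_le])
    from bound[OF this] show ?thesis by (simp add: Q_def)
  qed
  have ReQ: "Re (Q z) > 0" if "z \<in> unit_disc" for z
  proof -
    have "\<bar>Re (Q z) - 1\<bar> < 1 - exp (-1)"
      using small[OF that] abs_Re_le_cmod[of "Q z - 1"] by simp
    then show ?thesis using exp_gt_zero[of "-1::real"] by linarith
  qed
  have "(\<lambda>z. Ln (Q z)) holomorphic_on unit_disc"
  proof (intro holomorphic_intros Qhol)
    show "Q z \<notin> \<real>\<^sub>\<le>\<^sub>0" if "z \<in> unit_disc" for z
      using ReQ[OF that] by (simp add: complex_nonpos_Reals_iff)
  qed
  moreover have "(\<lambda>z. Ln (Q z)) ` unit_disc \<subseteq> unit_disc"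
    using norm_Ln_less_1[OF small] by auto
  moreover have "Ln (Q 0) = 0" by (simp add: Q_def euler_logderiv_def)
  moreover have "quot (\<lambda>z. z * deriv F z) F z = exp (Ln (Q z))" if "z \<in> unit_disc" for z
    using ReQ[OF that] qF[OF that] by (subst exp_Ln) auto
  moreover have "quot (\<lambda>z. z * deriv F z) F holomorphic_on unit_disc"
    by (rule holomorphic_transform[OF Qhol]) (simp add: qF)
  ultimately have "subordinate (quot (\<lambda>z. z * deriv F z) F) exp"
    unfolding subordinate_def
    by (intro conjI exI[of _ "\<lambda>z. Ln (Q z)"] ballI) (auto intro!: holomorphic_intros)
  moreover have "F \<in> class_A"
  proof -
    have "(\<lambda>z. z * h (of_real r * z)) \<in> class_A"
      by (rule class_A_timesI) (use hr h in auto)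
    moreover have eq: "F z = z * h (of_real r * z)" if "z \<in> unit_disc" for z
      using f[OF disc[OF that]] r by (simp add: F_def)
    moreover have "deriv F 0 = deriv (\<lambda>z. z * h (of_real r * z)) 0"
      by (rule deriv_cong_ev[OF eventually_mono[OF eventually_nhds_in_open[of unit_disc 0] eq]]) auto
    moreover have "F holomorphic_on unit_disc \<longleftrightarrow> (\<lambda>z. z * h (of_real r * z)) holomorphic_on unit_disc"
      by (rule holomorphic_cong[OF refl eq])
    ultimately show ?thesis by (simp add: class_A_def)
  qed
  ultimately show ?thesis
    by (simp add: starlike_exp_def starlike_class_def F_def)
qed

text \<open>The cofactor \<open>h = f / z\<close> is the object to which the logarithmic derivative estimates apply; \<open>B\<close> is a
  bound for them that depends on the modulus of the point only, so that it can serve for a whole class.\<close>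

definition cofactor_bound :: "(complex \<Rightarrow> complex) \<Rightarrow> (real \<Rightarrow> real) \<Rightarrow> bool" where
  "cofactor_bound f B \<longleftrightarrow> (\<exists>h. h holomorphic_on unit_disc \<and> h 0 = 1 \<and>
     (\<forall>z\<in>unit_disc. h z \<noteq> 0 \<and> f z = z * h z \<and> norm (euler_logderiv h z) \<le> B (norm z)))"

lemma radius_candidateI:
  assumes R: "0 < R" "R < 1"
    and B: "\<And>f. f \<in> \<F> \<Longrightarrow> cofactor_bound f B"
    and small: "\<And>r. 0 \<le> r \<Longrightarrow> r < R \<Longrightarrow> B r < 1 - exp (-1)"
  shows "R \<in> radius_candidates starlike_exp \<F>"
  unfolding radius_candidates_def
proof (intro CollectI conjI ballI allI impI)
  fix f r assume f: "f \<in> \<F>" and r: "0 < r \<and> r < R"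
  from B[OF f] obtain h where h: "h holomorphic_on unit_disc" "h 0 = 1"
    "\<And>z. z \<in> unit_disc \<Longrightarrow> h z \<noteq> 0" "\<And>z. z \<in> unit_disc \<Longrightarrow> f z = z * h z"
    "\<And>z. z \<in> unit_disc \<Longrightarrow> norm (euler_logderiv h z) \<le> B (norm z)"
    unfolding cofactor_bound_def by blast
  have "norm (euler_logderiv h z) < 1 - exp (-1)" if "norm z < R" for z
    using h(5)[of z] small[of "norm z"] that R by simp
  with h r R show "(\<lambda>z. f (complex_of_real r * z) / complex_of_real r) \<in> starlike_exp"
    by (intro scaled_starlike_exp[of h f r R]) auto
qed (use R in auto)

lemma class_G3_cofactor_bound:
  assumes f: "f \<in> class_G3"
  shows "cofactor_bound f (\<lambda>r. 4 * r / (1 - r\<^sup>2))"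
proof -
  obtain p where fA: "f \<in> class_A" and p: "p \<in> class_P"
    and qP: "quot f (\<lambda>z. z * p z) \<in> class_P" using f by (auto simp: class_G3_def)
  define q where "q = quot f (\<lambda>z. z * p z)"
  have q: "q \<in> class_P" using qP by (simp add: q_def)
  have "f z = z * (p z * q z)" if "z \<in> unit_disc" for z
    using quot_mult_class_P[of f p z] fA p q that by (simp add: q_def class_A_def mult_ac)
  moreover have "norm (euler_logderiv (\<lambda>z. p z * q z) z) \<le> 4 * norm z / (1 - (norm z)\<^sup>2)"
    if z: "norm z < 1" for z
  proof -
    have "euler_logderiv (\<lambda>z. p z * q z) z = euler_logderiv p z + euler_logderiv q z"
      using class_P_D[OF p] class_P_D[OF q] z by (intro euler_logderiv_mult) auto
    also have "norm \<dots> \<le> 2 * norm z / (1 - (norm z)\<^sup>2) + 2 * norm z / (1 - (norm z)\<^sup>2)"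
      by (intro norm_triangle_mono class_P_euler_logderiv_le p q z)
    finally show ?thesis by simp
  qed
  ultimately show ?thesis
    using class_P_D[OF p] class_P_D[OF q] unfolding cofactor_bound_def
    by (intro exI[of _ "\<lambda>z. p z * q z"]) (auto intro!: holomorphic_intros)
qed

text \<open>The first two classes differ only in what is known about the middle factor \<open>g / (z * p)\<close>, whose
  bound \<open>B\<close> is therefore left open. The other two factors contribute \<open>2 * r / (1 - r\<^sup>2)\<close> each.\<close>

lemma three_factor_cofactor_bound:
  assumes f: "f \<in> class_A" and g: "g \<in> class_A" and p: "p \<in> class_P"
    and P: "quot f g \<in> class_P" "quot g (\<lambda>z. z * p z) \<in> class_P"
    and B: "\<And>z. norm z < 1 \<Longrightarrow> norm (euler_logderiv (quot g (\<lambda>z. z * p z)) z) \<le> B (norm z)"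
  shows "cofactor_bound f (\<lambda>r. 4 * r / (1 - r\<^sup>2) + B r)"
proof -
  define q s where "q = quot g (\<lambda>z. z * p z)" and "s = quot f g"
  have q: "q \<in> class_P" and s: "s \<in> class_P" using P by (auto simp: q_def s_def)
  note D = class_P_D[OF p] class_P_D[OF q] class_P_D[OF s]
  have "f z = z * (p z * q z * s z)" if "z \<in> unit_disc" for z
    unfolding q_def s_def by (rule three_factor_factorization[OF f g p P that])
  moreover have "norm (euler_logderiv (\<lambda>z. p z * q z * s z) z)
      \<le> 4 * norm z / (1 - (norm z)\<^sup>2) + B (norm z)" if z: "norm z < 1" for z
  proof -
    have "euler_logderiv (\<lambda>z. p z * q z * s z) z
        = euler_logderiv p z + euler_logderiv q z + euler_logderiv s z"
      using D z
      by (subst euler_logderiv_mult euler_logderiv_mult[of p q]; auto intro!: holomorphic_intros)+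
    also have "norm \<dots> \<le> 2 * norm z / (1 - (norm z)\<^sup>2) + B (norm z) + 2 * norm z / (1 - (norm z)\<^sup>2)"
      using B[OF z] by (intro norm_triangle_mono class_P_euler_logderiv_le p s z) (simp add: q_def)
    finally show ?thesis by simp
  qed
  ultimately show ?thesis using D unfolding cofactor_bound_def
    by (intro exI[of _ "\<lambda>z. p z * q z * s z"]) (auto intro!: holomorphic_intros)
qed

section \<open>Extremal functions\<close>

text \<open>The conformal map of the disc onto the right half-plane. It attains the bound of
  \<open>class_P_euler_logderiv_le\<close> at all real points, which makes its powers extremal.\<close>

definition cayley :: "complex \<Rightarrow> complex" where
  "cayley z = (1 + z) / (1 - z)"

lemma cayley_class_P: "cayley \<in> class_P"
proof -
  have "Re (cayley z) > 0" if "norm z < 1" for z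
  proof -
    have z1: "1 - z \<noteq> 0" using that by auto
    have "Re (cayley z) = (1 - (norm z)\<^sup>2) / (norm (1 - z))\<^sup>2"
      unfolding cayley_def Re_divide' cmod_power2 by (simp add: power2_eq_square algebra_simps)
    moreover have "(norm z)\<^sup>2 < 1" using that by (simp add: abs_square_less_1)
    ultimately show ?thesis using z1 by simp
  qed
  then show ?thesis
    unfolding class_P_def cayley_def by (auto intro!: holomorphic_intros)
qed

lemma euler_logderiv_cayley:
  assumes "norm z < 1"
  shows "euler_logderiv cayley z = 2 * z / (1 - z\<^sup>2)"
proof -
  have nz: "1 - z \<noteq> 0" "1 + z \<noteq> 0"
    using assms by (auto simp: add_eq_0_iff)
  have "(cayley has_field_derivative (1 * (1 - z) - (1 + z) * (-1)) / ((1 - z) * (1 - z))) (at z)"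
    unfolding cayley_def using nz by (auto intro!: derivative_eq_intros)
  then have "deriv cayley z = 2 / ((1 - z) * (1 - z))" by (simp add: DERIV_imp_deriv)
  moreover have "1 - z\<^sup>2 = (1 - z) * (1 + z)" by (simp add: power2_eq_square algebra_simps)
  ultimately show ?thesis using nz by (simp add: euler_logderiv_def cayley_def)
qed

lemma euler_logderiv_cayley_power:
  assumes z: "norm z < 1"
  shows "euler_logderiv (\<lambda>z. cayley z ^ n) z = of_nat n * (2 * z / (1 - z\<^sup>2))"
proof (induction n)
  case 0
  then show ?case by (simp add: euler_logderiv_def)
next
  case (Suc n)
  have "euler_logderiv (\<lambda>z. cayley z * cayley z ^ n) z
      = euler_logderiv cayley z + euler_logderiv (\<lambda>z. cayley z ^ n) z"
    using class_P_D[OF cayley_class_P] z by (intro euler_logderiv_mult holomorphic_intros) auto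
  then show ?case using Suc euler_logderiv_cayley[OF z] by (simp add: add_divide_distrib algebra_simps)
qed

lemma cayley_class_A: "(\<lambda>z. z * cayley z ^ n) \<in> class_A"
  using class_P_D(1,2)[OF cayley_class_P] by (intro class_A_timesI holomorphic_intros) auto

lemma quot_cayley_power:
  assumes "m = Suc n"
  shows "quot (\<lambda>z. z * cayley z ^ m) (\<lambda>z. z * cayley z ^ n) \<in> class_P"
proof (rule class_P_cong[OF cayley_class_P])
  show "quot (\<lambda>z. z * cayley z ^ m) (\<lambda>z. z * cayley z ^ n) z = cayley z" if "z \<in> unit_disc" for z
    by (rule quot_eqI[OF class_P_D(1)[OF cayley_class_P] that])
       (use class_P_D(4)[OF cayley_class_P] assms in auto)
qed

lemma cayley2_class_G3: "(\<lambda>z. z * cayley z ^ 2) \<in> class_G3"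
proof -
  have "quot (\<lambda>z. z * cayley z ^ 2) (\<lambda>z. z * cayley z) \<in> class_P"
    using quot_cayley_power[of 2 1] by simp
  then show ?thesis
    unfolding class_G3_def using cayley_class_A cayley_class_P by blast
qed

lemma cayley3_class_G1: "(\<lambda>z. z * cayley z ^ 3) \<in> class_G1"
proof -
  have "quot (\<lambda>z. z * cayley z ^ 3) (\<lambda>z. z * cayley z ^ 2) \<in> class_P"
    "quot (\<lambda>z. z * cayley z ^ 2) (\<lambda>z. z * cayley z) \<in> class_P"
    using quot_cayley_power[of 3 2] quot_cayley_power[of 2 1] by simp_all
  then show ?thesis
    unfolding class_G1_def using cayley_class_A cayley_class_P by blast
qed

text \<open>The constant function 1 has real part above one half, so \<open>g = z * p\<close> is admissible in the second class.\<close>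

lemma class_G3_subset_G2: "class_G3 \<subseteq> class_G2"
proof
  fix f assume "f \<in> class_G3"
  then obtain p where f: "f \<in> class_A" and p: "p \<in> class_P"
    and q: "quot f (\<lambda>z. z * p z) \<in> class_P" by (auto simp: class_G3_def)
  have g: "(\<lambda>z. z * p z) \<in> class_A" using class_P_D[OF p] by (intro class_A_timesI)
  have "quot (\<lambda>z. z * p z) (\<lambda>z. z * p z) z = 1" if "z \<in> unit_disc" for z
    by (rule quot_eqI[OF _ that, of "\<lambda>_. 1"]) (use class_P_D(4)[OF p] in auto)
  moreover from this have "quot (\<lambda>z. z * p z) (\<lambda>z. z * p z) \<in> class_P"
    by (rule class_P_cong[of "\<lambda>_. 1", rotated]) (auto simp: class_P_def)
  ultimately have "quot (\<lambda>z. z * p z) (\<lambda>z. z * p z) \<in> class_P_half"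
    by (simp add: class_P_half_def)
  then show "f \<in> class_G2" using f p q g by (auto simp: class_G2_def)
qed

text \<open>If a larger radius \<open>R'\<close> were possible, rescaling the extremal function by some \<open>r\<close> between
  \<open>R\<close> and \<open>R'\<close> would bring the point \<open>- R\<close> into the disc, at \<open>z = - R / r\<close>. There the subordination forces
  \<open>exp (w z) = exp (- 1)\<close>, hence \<open>Re (w z) = - 1\<close>, which is impossible for \<open>norm (w z) < 1\<close>.\<close>

lemma radius_candidate_le_extremal:
  fixes R :: real and n :: nat
  assumes cand: "R' \<in> radius_candidates starlike_exp \<F>" and ext: "(\<lambda>z. z * cayley z ^ n) \<in> \<F>"
    and R: "0 < R" "2 * real n * R / (1 - R\<^sup>2) = 1 - exp (-1)"
  shows "R' \<le> R"
proof (rule ccontr)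
  assume "\<not> R' \<le> R"
  then obtain r where r: "R < r" "r < R'" using dense[of R R'] by auto
  have r1: "0 < r" "r < 1" using r R cand by (auto simp: radius_candidates_def)
  define F where "F = (\<lambda>z. (of_real r * z) * cayley (of_real r * z) ^ n / complex_of_real r)"
  have "F \<in> starlike_exp"
    using cand ext r r1 unfolding radius_candidates_def F_def by fastforce
  then obtain w where w: "w ` unit_disc \<subseteq> unit_disc"
    "\<And>z. z \<in> unit_disc \<Longrightarrow> quot (\<lambda>z. z * deriv F z) F z = exp (w z)"
    by (auto simp: starlike_exp_def starlike_class_def subordinate_def)
  define z where "z = - complex_of_real (R / r)"
  have z: "z \<in> unit_disc" using R r r1 by (simp add: z_def norm_divide)
  have rz: "of_real r * z = - complex_of_real R" using r1 by (simp add: z_def)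
  have "exp (w z) = 1 + euler_logderiv (\<lambda>z. cayley z ^ n) (of_real r * z)"
    unfolding w(2)[OF z, symmetric] F_def
    using class_P_D(1,4)[OF cayley_class_P]
    by (intro scaled_quot[OF _ _ _ r1 z]) (auto intro!: holomorphic_intros)
  also have "\<dots> = of_real (1 - 2 * real n * R / (1 - R\<^sup>2))"
    using R(1) r r1 by (subst euler_logderiv_cayley_power) (auto simp: rz)
  also have "\<dots> = of_real (exp (-1))" using R by simp
  finally have "norm (exp (w z)) = norm (complex_of_real (exp (-1)))" by (rule arg_cong)
  then have "exp (Re (w z)) = exp (-1)" by simp
  then have "Re (w z) = -1" by simp
  moreover have "w z \<in> unit_disc" using w(1) z by blast
  ultimately show False using abs_Re_le_cmod[of "w z"] by simp
qed

section \<open>The quadratic equations for the radii\<close>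

text \<open>The rationalized form of the positive root of \<open>a * x\<^sup>2 + b * x = c\<close>. The last claim makes every
  comparison with the root, numerical ones included, a polynomial inequality.\<close>

lemma quadratic_root:
  fixes a b c :: real
  assumes "a > 0" "b > 0" "c > 0"
  defines "\<rho> \<equiv> 2 * c / (b + sqrt (b\<^sup>2 + 4 * a * c))"
  shows "0 < \<rho>" "a * \<rho>\<^sup>2 + b * \<rho> = c" "\<And>x. 0 \<le> x \<Longrightarrow> x < \<rho> \<longleftrightarrow> a * x\<^sup>2 + b * x < c"
proof -
  define s where "s = sqrt (b\<^sup>2 + 4 * a * c)"
  have s: "s\<^sup>2 = b\<^sup>2 + 4 * a * c" "s \<ge> 0" using assms by (auto simp: s_def)
  have bs: "b + s > 0" using s assms by simp
  show pos: "0 < \<rho>" using bs assms by (simp add: \<rho>_def s_def)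
  have \<rho>: "\<rho> * (b + s) = 2 * c" using bs by (simp add: \<rho>_def s_def)
  have "c * (a * \<rho>\<^sup>2 + b * \<rho> - c) * 4 = 4 * a * c * \<rho>\<^sup>2 + 2 * b * \<rho> * (2 * c) - (2 * c)\<^sup>2"
    by (simp add: power2_eq_square algebra_simps)
  also have "\<dots> = (s\<^sup>2 - b\<^sup>2) * \<rho>\<^sup>2 + 2 * b * \<rho> * (\<rho> * (b + s)) - (\<rho> * (b + s))\<^sup>2"
    using s by (simp add: \<rho>)
  also have "\<dots> = 0" by (simp add: power2_eq_square algebra_simps)
  finally show root: "a * \<rho>\<^sup>2 + b * \<rho> = c" using assms by simp
  fix x :: real assume x: "0 \<le> x"
  have "a * x\<^sup>2 + b * x - c = (x - \<rho>) * (a * (x + \<rho>) + b)"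
    using root by (simp add: power2_eq_square algebra_simps)
  moreover have "a * (x + \<rho>) + b > 0" using assms x pos by (simp add: add_nonneg_pos)
  ultimately show "x < \<rho> \<longleftrightarrow> a * x\<^sup>2 + b * x < c"
    by (smt (verit) mult_less_0_iff zero_le_mult_iff)
qed

lemma exp_minus_1_field: "exp (- 1 :: real) = 1 / euler_e"
  by (simp add: exp_minus inverse_eq_divide)

lemma euler_e_bounds: "2.71828 < euler_e" "euler_e < 2.71829"
  using e_approx_32 by (auto simp: abs_if split: if_splits)

text \<open>The coefficient \<open>k\<close> is arbitrary, so it may depend on \<open>r\<close>; the estimate for the second class uses
  \<open>k = 5 + r\<close>.\<close>

lemma logderiv_bound_iff:
  assumes "0 \<le> r" "r < 1"
  shows "k * r / (1 - r\<^sup>2) < 1 - exp (-1) \<longleftrightarrow> (euler_e - 1) * r\<^sup>2 + k * euler_e * r < euler_e - 1"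
    and "k * r / (1 - r\<^sup>2) = 1 - exp (-1) \<longleftrightarrow> (euler_e - 1) * r\<^sup>2 + k * euler_e * r = euler_e - 1"
proof -
  have "0 < 1 - r\<^sup>2" using assms by (simp add: power_less_one_iff abs_square_less_1)
  then show "k * r / (1 - r\<^sup>2) < 1 - exp (-1) \<longleftrightarrow> (euler_e - 1) * r\<^sup>2 + k * euler_e * r < euler_e - 1"
    "k * r / (1 - r\<^sup>2) = 1 - exp (-1) \<longleftrightarrow> (euler_e - 1) * r\<^sup>2 + k * euler_e * r = euler_e - 1"
    unfolding exp_minus_1_field by (auto simp: divide_simps algebra_simps)
qed

text \<open>The positive root of \<open>(e - 1) * r\<^sup>2 + 2 * n * e * r = e - 1\<close>, the radius for a product of \<open>n\<close>
  functions with positive real part. Keeping the form of \<open>quadratic_root\<close> allows that lemma to be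
  applied for all \<open>n\<close> at once.\<close>

definition factor_radius :: "nat \<Rightarrow> real" where
  "factor_radius n = 2 * (euler_e - 1) /
     (2 * real n * euler_e + sqrt ((2 * real n * euler_e)\<^sup>2 + 4 * (euler_e - 1) * (euler_e - 1)))"

lemma factor_radius:
  assumes "n > 0"
  shows "0 < factor_radius n" "factor_radius n < 1"
    and "\<And>x. 0 \<le> x \<Longrightarrow> x < factor_radius n \<longleftrightarrow>
      (euler_e - 1) * x\<^sup>2 + 2 * real n * euler_e * x < euler_e - 1"
    and "2 * real n * factor_radius n / (1 - (factor_radius n)\<^sup>2) = 1 - exp (-1)"
    and "\<And>r. 0 \<le> r \<Longrightarrow> r < factor_radius n \<Longrightarrow> 2 * real n * r / (1 - r\<^sup>2) < 1 - exp (-1)"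
proof -
  have pos: "euler_e - 1 > 0" "2 * real n * euler_e > 0" using assms by auto
  note Q = quadratic_root[OF pos(1) pos(2) pos(1), folded factor_radius_def]
  show "0 < factor_radius n" by (rule Q(1))
  have "\<not> 1 < factor_radius n" "factor_radius n \<noteq> 1" using Q(2) Q(3)[of 1] pos by auto
  then show lt1: "factor_radius n < 1" by simp
  show "\<And>x. 0 \<le> x \<Longrightarrow> x < factor_radius n \<longleftrightarrow>
      (euler_e - 1) * x\<^sup>2 + 2 * real n * euler_e * x < euler_e - 1" by (rule Q(3))
  show "2 * real n * factor_radius n / (1 - (factor_radius n)\<^sup>2) = 1 - exp (-1)"
    using Q(1,2) lt1 by (subst logderiv_bound_iff) auto
  show "2 * real n * r / (1 - r\<^sup>2) < 1 - exp (-1)" if "0 \<le> r" "r < factor_radius n" for r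
    using that Q(3)[of r] lt1 by (subst logderiv_bound_iff) auto
qed

section \<open>The three radii\<close>

lemma is_radius_G1: "is_radius starlike_exp class_G1 (factor_radius 3)"
proof -
  have bound: "cofactor_bound f (\<lambda>r. 4 * r / (1 - r\<^sup>2) + 2 * r / (1 - r\<^sup>2))"
    if "f \<in> class_G1" for f
  proof -
    obtain g p where fgp: "f \<in> class_A" "g \<in> class_A" "p \<in> class_P" "quot f g \<in> class_P"
      and P: "quot g (\<lambda>z. z * p z) \<in> class_P" using \<open>f \<in> class_G1\<close> by (auto simp: class_G1_def)
    from fgp show ?thesis
      by (rule three_factor_cofactor_bound[where B = "\<lambda>r. 2 * r / (1 - r\<^sup>2)",
            OF _ _ _ _ P class_P_euler_logderiv_le[OF P]])
  qed
  have "factor_radius 3 \<in> radius_candidates starlike_exp class_G1"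
    by (rule radius_candidateI[OF _ _ bound])
       (use factor_radius(1,2,5)[of 3] in \<open>auto simp flip: add_divide_distrib\<close>)
  moreover have "R' \<le> factor_radius 3" if "R' \<in> radius_candidates starlike_exp class_G1" for R'
    by (rule radius_candidate_le_extremal[OF that cayley3_class_G1]) (use factor_radius[of 3] in auto)
  ultimately show ?thesis by (simp add: is_radius_def)
qed

lemma is_radius_G3: "is_radius starlike_exp class_G3 (factor_radius 2)"
proof -
  have "factor_radius 2 \<in> radius_candidates starlike_exp class_G3"
    by (rule radius_candidateI[OF _ _ class_G3_cofactor_bound])
       (use factor_radius(1,2,5)[of 2] in auto)
  moreover have "R' \<le> factor_radius 2" if "R' \<in> radius_candidates starlike_exp class_G3" for R'
    by (rule radius_candidate_le_extremal[OF that cayley2_class_G3]) (use factor_radius[of 2] in auto)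
  ultimately show ?thesis by (simp add: is_radius_def)
qed

lemma radius_candidates_antimono:
  "\<F> \<subseteq> \<F>' \<Longrightarrow> radius_candidates \<G> \<F>' \<subseteq> radius_candidates \<G> \<F>"
  by (auto simp: radius_candidates_def)

text \<open>The defining property of a candidate concerns only dilations \<open>r < R\<close>, so it passes to suprema; the
  bound \<open>B < 1\<close> ensures that the supremum stays in the open unit interval.\<close>

lemma radius_exists:
  assumes b: "b \<in> radius_candidates \<G> \<F>" and B: "B < 1"
    "\<And>R. R \<in> radius_candidates \<G> \<F> \<Longrightarrow> R \<le> B"
  shows "\<exists>R. is_radius \<G> \<F> R \<and> R \<ge> b"
proof -
  let ?C = "radius_candidates \<G> \<F>"
  have bdd: "bdd_above ?C" by (rule bdd_aboveI[OF B(2)])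
  have ge: "R \<le> Sup ?C" if "R \<in> ?C" for R using that bdd by (rule cSup_upper)
  have "Sup ?C \<le> B" using b B by (intro cSup_least) auto
  moreover have "0 < b" using b by (simp add: radius_candidates_def)
  moreover have "(\<lambda>z. f (complex_of_real r * z) / complex_of_real r) \<in> \<G>"
    if f: "f \<in> \<F>" and r: "0 < r" "r < Sup ?C" for f r
  proof -
    obtain R where "R \<in> ?C" "r < R" using less_cSup_iff[OF _ bdd, of r] r b by blast
    then show ?thesis using f r by (auto simp: radius_candidates_def)
  qed
  ultimately have "Sup ?C \<in> ?C"
    using ge[OF b] B unfolding radius_candidates_def by auto
  then show ?thesis using ge b by (auto simp: is_radius_def)
qed

text \<open>The three bounds add up to \<open>(5 + r) * r / (1 - r\<^sup>2)\<close>. Their sum is below \<open>1 - 1/e\<close> exactly if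
  \<open>(2 * e - 1) * r\<^sup>2 + 5 * e * r < e - 1\<close>, and the hypothesis implies this because \<open>e < 3\<close>.\<close>

lemma radius_candidate_G2:
  assumes b: "0 < b" "b < 1"
    and ineq: "\<And>x. 0 \<le> x \<Longrightarrow> x < b \<Longrightarrow> (euler_e + 2) * x\<^sup>2 + 5 * euler_e * x < euler_e - 1"
  shows "b \<in> radius_candidates starlike_exp class_G2"
proof (rule radius_candidateI[OF b])
  show "cofactor_bound f (\<lambda>r. 4 * r / (1 - r\<^sup>2) + r / (1 - r))" if "f \<in> class_G2" for f
  proof -
    obtain g p where fgp: "f \<in> class_A" "g \<in> class_A" "p \<in> class_P" "quot f g \<in> class_P"
      and half: "quot g (\<lambda>z. z * p z) \<in> class_P_half"
      using \<open>f \<in> class_G2\<close> by (auto simp: class_G2_def)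
    then have "quot g (\<lambda>z. z * p z) \<in> class_P" by (simp add: class_P_half_def)
    with fgp show ?thesis
      by (rule three_factor_cofactor_bound[where B = "\<lambda>r. r / (1 - r)",
            OF _ _ _ _ _ class_P_half_euler_logderiv_le[OF half]])
  qed
next
  fix r :: real assume r: "0 \<le> r" "r < b"
  have sq: "1 - r\<^sup>2 = (1 - r) * (1 + r)" by (simp add: power2_eq_square algebra_simps)
  have "4 * r / (1 - r\<^sup>2) + r / (1 - r) = (5 + r) * r / (1 - r\<^sup>2)"
    unfolding sq using r b by (simp add: divide_simps) (simp add: algebra_simps)
  also have "\<dots> < 1 - exp (-1)"
  proof (subst logderiv_bound_iff)
    have "(euler_e - 1) * r\<^sup>2 + (5 + r) * euler_e * r = (2 * euler_e - 1) * r\<^sup>2 + 5 * euler_e * r"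
      by (simp add: power2_eq_square algebra_simps)
    also have "\<dots> \<le> (euler_e + 2) * r\<^sup>2 + 5 * euler_e * r"
      using euler_e_bounds by (intro add_right_mono mult_right_mono) auto
    also have "\<dots> < euler_e - 1" by (rule ineq[OF r])
    finally show "(euler_e - 1) * r\<^sup>2 + (5 + r) * euler_e * r < euler_e - 1" .
  qed (use r b in auto)
  finally show "4 * r / (1 - r\<^sup>2) + r / (1 - r) < 1 - exp (-1)" .
qed

lemma half_sqrt_quotient:
  fixes c d x :: real
  shows "2 * c / (2 * d + sqrt (4 * x)) = c / (d + sqrt x)"
proof -
  have "2 * d + sqrt (4 * x) = 2 * (d + sqrt x)" by (simp add: real_sqrt_mult)
  then show ?thesis by (simp only: mult_divide_mult_cancel_left_if) simp
qed

theorem theorem3p4: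
  shows "(let R1 = (euler_e - 1) / (3 * euler_e + sqrt (10 * euler_e^2 - 2 * euler_e + 1))
          in is_radius starlike_exp class_G1 R1 \<and> \<bar>R1 - 0.1042\<bar> < 0.00005) \<and>
         (let b2 = 2 * (euler_e^2 + euler_e - 2) /
                   ((2 + euler_e) * (5 * euler_e + sqrt (- 8 + 4 * euler_e + 29 * euler_e^2)))
          in (\<exists>R2. is_radius starlike_exp class_G2 R2 \<and> R2 \<ge> b2) \<and> \<bar>b2 - 0.1213\<bar> < 0.00005) \<and>
         (let R3 = 2 * (euler_e^2 - 1) /
                   ((euler_e + 1) * (4 * euler_e + sqrt (4 - 8 * euler_e + 20 * euler_e^2)))
          in is_radius starlike_exp class_G3 R3 \<and> \<bar>R3 - 0.1543\<bar> < 0.00005)"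
proof -
  define b2 where "b2 = 2 * (euler_e - 1) /
    (5 * euler_e + sqrt ((5 * euler_e)\<^sup>2 + 4 * (euler_e + 2) * (euler_e - 1)))"
  have e2: "2 + euler_e > 0" "euler_e + 1 > 0" by (simp_all add: add_pos_pos)
  \<comment> \<open>The stated forms reduce to the rationalized roots by taking a factor 4 out of the root in the
    first case and by cancelling \<open>e + 1\<close> or \<open>e + 2\<close> in the others.\<close>
  have R1: "(euler_e - 1) / (3 * euler_e + sqrt (10 * euler_e^2 - 2 * euler_e + 1)) = factor_radius 3"
  proof -
    have eq: "(2 * real 3 * euler_e)\<^sup>2 + 4 * (euler_e - 1) * (euler_e - 1)
        = 4 * (10 * euler_e^2 - 2 * euler_e + 1)"
      by (simp add: power2_eq_square algebra_simps)
    have "factor_radius 3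
        = 2 * (euler_e - 1) / (2 * (3 * euler_e) + sqrt (4 * (10 * euler_e^2 - 2 * euler_e + 1)))"
      unfolding factor_radius_def eq by simp
    also have "\<dots> = (euler_e - 1) / (3 * euler_e + sqrt (10 * euler_e^2 - 2 * euler_e + 1))"
      by (rule half_sqrt_quotient)
    finally show ?thesis by (rule sym)
  qed
  have R3: "2 * (euler_e^2 - 1) /
      ((euler_e + 1) * (4 * euler_e + sqrt (4 - 8 * euler_e + 20 * euler_e^2))) = factor_radius 2"
  proof -
    have "(2 * real 2 * euler_e)\<^sup>2 + 4 * (euler_e - 1) * (euler_e - 1)
        = 4 - 8 * euler_e + 20 * euler_e^2"
      by (simp add: power2_eq_square algebra_simps)
    moreover have "2 * (euler_e^2 - 1) = (euler_e + 1) * (2 * (euler_e - 1))"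
      by (simp add: power2_eq_square algebra_simps)
    ultimately show ?thesis using e2 by (simp add: factor_radius_def)
  qed
  have B2: "2 * (euler_e^2 + euler_e - 2) /
      ((2 + euler_e) * (5 * euler_e + sqrt (- 8 + 4 * euler_e + 29 * euler_e^2))) = b2"
  proof -
    have "(5 * euler_e)\<^sup>2 + 4 * (euler_e + 2) * (euler_e - 1) = - 8 + 4 * euler_e + 29 * euler_e^2"
      by (simp add: power2_eq_square algebra_simps)
    moreover have "2 * (euler_e^2 + euler_e - 2) = (2 + euler_e) * (2 * (euler_e - 1))"
      by (simp add: power2_eq_square algebra_simps)
    ultimately show ?thesis using e2 by (simp add: b2_def)
  qed
  have Q: "0 < b2"
    "\<And>x. 0 \<le> x \<Longrightarrow> x < b2 \<longleftrightarrow> (euler_e + 2) * x\<^sup>2 + 5 * euler_e * x < euler_e - 1"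
    using quadratic_root[of "euler_e + 2" "5 * euler_e" "euler_e - 1", folded b2_def] e2 by auto
  \<comment> \<open>In each case the two rational points enclose the constant within the required accuracy, and
    comparing the quadratic with \<open>e - 1\<close> at them is linear in \<open>e\<close>.\<close>
  have "0.10416 < factor_radius 3"
    by (subst factor_radius(3)) (use euler_e_bounds in \<open>simp_all add: power2_eq_square field_simps\<close>)
  moreover have "\<not> 0.10424 < factor_radius 3"
    by (subst factor_radius(3)) (use euler_e_bounds in \<open>simp_all add: power2_eq_square field_simps\<close>)
  ultimately have num1: "\<bar>factor_radius 3 - 0.1042\<bar> < 0.00005" by (simp add: abs_if)
  have "0.15426 < factor_radius 2"
    by (subst factor_radius(3)) (use euler_e_bounds in \<open>simp_all add: power2_eq_square field_simps\<close>)
  moreover have "\<not> 0.15434 < factor_radius 2"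
    by (subst factor_radius(3)) (use euler_e_bounds in \<open>simp_all add: power2_eq_square field_simps\<close>)
  ultimately have num3: "\<bar>factor_radius 2 - 0.1543\<bar> < 0.00005" by (simp add: abs_if)
  have "0.12126 < b2"
    by (subst Q(2)) (use euler_e_bounds in \<open>simp_all add: power2_eq_square field_simps\<close>)
  moreover have "\<not> 0.12134 < b2"
    by (subst Q(2)) (use euler_e_bounds in \<open>simp_all add: power2_eq_square field_simps\<close>)
  ultimately have num2: "\<bar>b2 - 0.1213\<bar> < 0.00005" by (simp add: abs_if)
  have "b2 < 1" using num2 by (simp add: abs_if split: if_splits)
  then have b2: "b2 \<in> radius_candidates starlike_exp class_G2"
    using Q by (intro radius_candidate_G2) auto
  have "\<exists>R2. is_radius starlike_exp class_G2 R2 \<and> R2 \<ge> b2"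
  proof (rule radius_exists[OF b2])
    show "factor_radius 2 < 1" by (rule factor_radius) simp
    show "R \<le> factor_radius 2" if "R \<in> radius_candidates starlike_exp class_G2" for R
      using that is_radius_G3 radius_candidates_antimono[OF class_G3_subset_G2]
      by (auto simp: is_radius_def)
  qed
  then show ?thesis
    unfolding Let_def R1 R3 B2 using is_radius_G1 is_radius_G3 num1 num2 num3 by blast
qed

end
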